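(* Let $T>0$ and let $A:\mathbb{R}\to\mathbb{H}^{n\times n}$ be continuous and $T$-periodic. Consider the system $\dot{\boldsymbol{x}}=A(t)\boldsymbol{x}$. (1) There is a nontrivial $T$-periodic solution if and only if $0$ is a characteristic exponent; or equivalently, if and only if $\rho=1$ is a characteristic multiplier. (2) If there is a characteristic exponent of the form $\mu=\frac{2k+1}{T}\pi\mathbf{i}$ for some $k\in\mathbb{Z}$, or equivalently, if $\rho=-1$ is a characteristic multiplier, then there is a nontrivial $2T$-periodic solution.
   Context: $\mathbb{H}$ is the real quaternion algebra with units $\mathbf{i},\mathbf{j},\mathbf{k}$, and $\mathbb{C}=\{a+b\mathbf{i}\}\subset\mathbb{H}$. The standard eigenvalues of $X\in\mathbb{H}^{n\times n}$ are the complex numbers $\lambda$ with nonnegative imaginary part such that $X\boldsymbol{\eta}=\boldsymbol{\eta}\lambda$ for some nonzero $\boldsymbol{\eta}\in\mathbb{H}^n$. A fundamental matrix of the system is an invertible $\mathbb{H}^{n\times n}$-valued solution $M(t)$ of $\dot M=A(t)M$; $M^{-1}(0)M(T)$ is called a monodromy matrix, and any two monodromy matrices are similar. The characteristic multipliers are the standard eigenvalues of any monodromy matrix. A complex number $\mu$ is a characteristic exponent if $e^{\mu T}$ is a characteristic multiplier. *)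

theory Defs
  imports "HOL-Analysis.Analysis"
begin

codatatype quat = Quat (qRe: real) (qI: real) (qJ: real) (qK: real)

lemma quat_eqI [intro?]:
  "\<lbrakk>qRe x = qRe y; qI x = qI y; qJ x = qJ y; qK x = qK y\<rbrakk> \<Longrightarrow> x = y"
  by (rule quat.expand) simp

lemma quat_eq_iff:
  "x = y \<longleftrightarrow> qRe x = qRe y \<and> qI x = qI y \<and> qJ x = qJ y \<and> qK x = qK y"
  by (auto intro: quat.expand)

instantiation quat :: ab_group_add
begin

primcorec zero_quat where
  "qRe 0 = 0" | "qI 0 = 0" | "qJ 0 = 0" | "qK 0 = 0"

primcorec plus_quat where
  "qRe (x + y) = qRe x + qRe y"
| "qI (x + y) = qI x + qI y"
| "qJ (x + y) = qJ x + qJ y"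
| "qK (x + y) = qK x + qK y"

primcorec uminus_quat where
  "qRe (- x) = - qRe x"
| "qI (- x) = - qI x"
| "qJ (- x) = - qJ x"
| "qK (- x) = - qK x"

primcorec minus_quat where
  "qRe (x - y) = qRe x - qRe y"
| "qI (x - y) = qI x - qI y"
| "qJ (x - y) = qJ x - qJ y"
| "qK (x - y) = qK x - qK y"

instance
  by standard (simp_all add: quat_eq_iff)

end

text \<open>The product is the one determined by
  \<open>i\<^sup>2 = j\<^sup>2 = k\<^sup>2 = i j k = -1\<close>.\<close>

instantiation quat :: ring_1
begin

primcorec one_quat where
  "qRe 1 = 1" | "qI 1 = 0" | "qJ 1 = 0" | "qK 1 = 0"

primcorec times_quat where
  "qRe (x * y) = qRe x * qRe y - qI x * qI y - qJ x * qJ y - qK x * qK y"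
| "qI (x * y) = qRe x * qI y + qI x * qRe y + qJ x * qK y - qK x * qJ y"
| "qJ (x * y) = qRe x * qJ y - qI x * qK y + qJ x * qRe y + qK x * qI y"
| "qK (x * y) = qRe x * qK y + qI x * qJ y - qJ x * qI y + qK x * qRe y"

instance
  by standard (simp_all add: quat_eq_iff algebra_simps)

end

lemma quat_unit_products:
  "Quat 0 1 0 0 * Quat 0 1 0 0 = - 1"
  "Quat 0 0 1 0 * Quat 0 0 1 0 = - 1"
  "Quat 0 0 0 1 * Quat 0 0 0 1 = - 1"
  "Quat 0 1 0 0 * Quat 0 0 1 0 * Quat 0 0 0 1 = - 1"
  by (simp_all add: quat_eq_iff)

instantiation quat :: real_algebra_1
begin

primcorec scaleR_quat where
  "qRe (scaleR r x) = r * qRe x"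
| "qI (scaleR r x) = r * qI x"
| "qJ (scaleR r x) = r * qJ x"
| "qK (scaleR r x) = r * qK x"

instance
  by standard (simp_all add: quat_eq_iff algebra_simps)

end

instantiation quat :: real_inner
begin

definition inner_quat where
  "inner x y = qRe x * qRe y + qI x * qI y + qJ x * qJ y + qK x * qK y"

definition norm_quat where
  "norm (x::quat) = sqrt (inner x x)"

definition dist_quat where
  "dist (x::quat) y = norm (x - y)"

definition sgn_quat where
  "sgn (x::quat) = x /\<^sub>R norm x"

definition uniformity_quat where
  "(uniformity :: (quat \<times> quat) filter) = (INF e\<in>{0<..}. principal {(x, y). dist x y < e})"

definition open_quat where
  "open (U :: quat set) \<longleftrightarrow> (\<forall>x\<in>U. eventually (\<lambda>(x', y). x' = x \<longrightarrow> y \<in> U) uniformity)"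

instance
proof
  fix x y z :: quat and r :: real
  show "dist x y = norm (x - y)" by (fact dist_quat_def)
  show "sgn x = x /\<^sub>R norm x" by (fact sgn_quat_def)
  show "(uniformity :: (quat \<times> quat) filter) = (INF e\<in>{0<..}. principal {(x, y). dist x y < e})"
    by (fact uniformity_quat_def)
  show "open U \<longleftrightarrow> (\<forall>x\<in>U. eventually (\<lambda>(x', y). x' = x \<longrightarrow> y \<in> U) uniformity)" for U :: "quat set"
    by (fact open_quat_def)
  show "norm x = sqrt (inner x x)" by (fact norm_quat_def)
  show "inner x y = inner y x" by (simp add: inner_quat_def mult.commute)
  show "inner (x + y) z = inner x z + inner y z" by (simp add: inner_quat_def algebra_simps)
  show "inner (scaleR r x) y = r * inner x y" by (simp add: inner_quat_def algebra_simps)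
  show "0 \<le> inner x x" by (simp add: inner_quat_def)
  show "inner x x = 0 \<longleftrightarrow> x = 0"
    by (simp add: inner_quat_def quat_eq_iff add_nonneg_eq_0_iff)
qed

end

instantiation quat :: real_normed_div_algebra
begin

definition inverse_quat where
  "inverse (x::quat) = Quat (qRe x) (- qI x) (- qJ x) (- qK x) /\<^sub>R (norm x)\<^sup>2"

definition divide_quat where
  "(x::quat) div y = x * inverse y"

instance
proof
  fix x y :: quat
  have sq: "(norm z)\<^sup>2 = qRe z * qRe z + qI z * qI z + qJ z * qJ z + qK z * qK z" for z :: quat
    by (simp add: power2_norm_eq_inner inner_quat_def)
  show "norm (x * y) = norm x * norm y"
  proof (rule power2_eq_imp_eq)
    show "(norm (x * y))\<^sup>2 = (norm x * norm y)\<^sup>2"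
      by (simp add: power_mult_distrib sq) (simp add: algebra_simps)
  qed simp_all
  show "x div y = x * inverse y" by (fact divide_quat_def)
  show "inverse (0::quat) = 0" by (simp add: inverse_quat_def quat_eq_iff)
  assume "x \<noteq> 0"
  then have nz: "(norm x)\<^sup>2 \<noteq> 0" by simp
  have 1: "x * Quat (qRe x) (- qI x) (- qJ x) (- qK x) = (norm x)\<^sup>2 *\<^sub>R 1"
    "Quat (qRe x) (- qI x) (- qJ x) (- qK x) * x = (norm x)\<^sup>2 *\<^sub>R 1"
    by (simp_all add: quat_eq_iff sq)
  show "inverse x * x = 1" "x * inverse x = 1"
    using nz by (simp_all add: inverse_quat_def 1)
qed

end

instantiation quat :: euclidean_space
begin

definition Basis_quat where
  "Basis = {Quat 1 0 0 0, Quat 0 1 0 0, Quat 0 0 1 0, Quat 0 0 0 1}"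

instance
proof
  show "(Basis :: quat set) \<noteq> {}" "finite (Basis :: quat set)"
    by (simp_all add: Basis_quat_def)
  show "inner u v = (if u = v then 1 else 0)" if "u \<in> Basis" "v \<in> Basis" for u v :: quat
    using that unfolding Basis_quat_def by (elim insertE emptyE) (simp_all add: inner_quat_def)
  show "(\<forall>u\<in>Basis. inner x u = 0) \<longleftrightarrow> x = 0" for x :: quat
    by (simp add: Basis_quat_def inner_quat_def quat_eq_iff [of x])
qed

end

definition quat_of_complex :: "complex \<Rightarrow> quat" where
  "quat_of_complex z = Quat (Re z) (Im z) 0 0"

text \<open>Eigenvalues are \<^emph>\<open>right\<close> eigenvalues: the scalar acts on the right of
  the eigenvector, whereas the matrix acts on the left.\<close>

definition standard_eigenvalue :: "quat ^ 'n ^ 'n \<Rightarrow> complex \<Rightarrow> bool" where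
  "standard_eigenvalue X l \<longleftrightarrow>
     0 \<le> Im l \<and> (\<exists>v :: quat ^ 'n. v \<noteq> 0 \<and> X *v v = (\<chi> i. v $ i * quat_of_complex l))"

definition is_solution :: "(real \<Rightarrow> quat ^ 'n ^ 'n) \<Rightarrow> (real \<Rightarrow> quat ^ 'n) \<Rightarrow> bool" where
  "is_solution A x \<longleftrightarrow> (\<forall>t. (x has_vector_derivative A t *v x t) (at t))"

definition fundamental_matrix ::
    "(real \<Rightarrow> quat ^ 'n ^ 'n) \<Rightarrow> (real \<Rightarrow> quat ^ 'n ^ 'n) \<Rightarrow> bool" where
  "fundamental_matrix A M \<longleftrightarrow>
     (\<forall>t. invertible (M t) \<and> (M has_vector_derivative A t ** M t) (at t))"

definition monodromy_matrix ::
    "(real \<Rightarrow> quat ^ 'n ^ 'n) \<Rightarrow> real \<Rightarrow> quat ^ 'n ^ 'n \<Rightarrow> bool" where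
  "monodromy_matrix A T X \<longleftrightarrow>
     (\<exists>M. fundamental_matrix A M \<and> X = matrix_inv (M 0) ** M T)"

text \<open>All monodromy matrices of a system are similar, hence share their
  standard eigenvalues, so it suffices to ask for one of them.\<close>

definition characteristic_multiplier ::
    "(real \<Rightarrow> quat ^ 'n ^ 'n) \<Rightarrow> real \<Rightarrow> complex \<Rightarrow> bool" where
  "characteristic_multiplier A T \<rho> \<longleftrightarrow>
     (\<exists>X. monodromy_matrix A T X \<and> standard_eigenvalue X \<rho>)"

definition characteristic_exponent ::
    "(real \<Rightarrow> quat ^ 'n ^ 'n) \<Rightarrow> real \<Rightarrow> complex \<Rightarrow> bool" where
  "characteristic_exponent A T \<mu> \<longleftrightarrow>
     characteristic_multiplier A T (exp (\<mu> * complex_of_real T))"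

definition nontrivial_periodic_solution ::
    "(real \<Rightarrow> quat ^ 'n ^ 'n) \<Rightarrow> real \<Rightarrow> (real \<Rightarrow> quat ^ 'n) \<Rightarrow> bool" where
  "nontrivial_periodic_solution A p x \<longleftrightarrow>
     is_solution A x \<and> (\<forall>t. x (t + p) = x t) \<and> (\<exists>t. x t \<noteq> 0)"

end

theory Submission imports Defs begin

text \<open>Let \<open>M\<close> be a fundamental matrix. If \<open>r\<close> is real, then
  \<open>matrix_inv (M 0) M(T) v = v r\<close> says that the solution \<open>x(t) = M(t) v\<close> satisfies \<open>x(T) = r x(0)\<close>.
  By periodicity of \<open>A\<close> both \<open>x(t + T)\<close> and \<open>r x(t)\<close> are solutions, so by uniqueness they agree
  for every \<open>t\<close>. Hence a real \<open>r\<close> is a multiplier iff some nonzero solution obeys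
  \<open>x(t + T) = r x(t)\<close> (\<open>characteristic_multiplier_real_iff\<close>). The value \<open>r = 1\<close> is
  \<open>T\<close>-periodicity, and \<open>r = -1\<close> gives \<open>x(t + 2 T) = x(t)\<close>; the claims about exponents are
  \<open>exp 0 = 1\<close> and \<open>exp ((2 k + 1) \<pi> \<i>) = -1\<close>.

  What this rests on is that fundamental matrices exist and that initial values determine
  solutions (\<open>ex_principal_fundamental_matrix\<close>). A continuous periodic \<open>A\<close> is bounded, so the
  equation is uniformly Lipschitz and has solutions on the whole line (\<open>global_Picard\<close>).
  Solving both \<open>M' = A M\<close> and the adjoint equation \<open>N' = - N A\<close> from the identity makes
  \<open>N M\<close> constant; this yields invertibility of \<open>M\<close>, as one-sided inverses of square matrices are
  two-sided by a dimension count over \<open>\<real>\<close>, and uniqueness because \<open>N x\<close> is constant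
  along solutions \<open>x\<close>.\<close>

section \<open>Global existence for uniformly Lipschitz equations\<close>

lemma ex_antiderivative_vanishing_at_0:
  fixes f :: "real \<Rightarrow> 'a::euclidean_space"
  assumes "continuous_on UNIV f"
  shows "\<exists>G. G 0 = 0 \<and> (\<forall>t. (G has_vector_derivative f t) (at t))"
proof -
  have "isCont f x" for x
    using assms by (simp add: continuous_on_eq_continuous_at)
  then obtain F where F: "\<And>t. (F has_vector_derivative f t) (at t)"
    using einterval_antiderivative[of "-\<infinity>" "\<infinity>" f] by auto
  have "((\<lambda>t. F t - F 0) has_vector_derivative f t) (at t)" for t
    by (simp add: has_vector_derivative_diff_const F)
  then show ?thesis by (intro exI[of _ "\<lambda>t. F t - F 0"]) simp
qed

lemma exp_weighted_growth_forward:
  fixes G :: "real \<Rightarrow> 'a::real_normed_vector"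
  assumes "K > 0" and "G 0 = 0"
    and der: "\<And>t. (G has_vector_derivative g t) (at t)"
    and bound: "\<And>t. norm (g t) \<le> C * K * exp (2 * K * \<bar>t\<bar>)"
    and "t \<ge> 0"
  shows "norm (G t) \<le> C / 2 * (exp (2 * K * t) - 1)"
proof (cases "t = 0")
  case True
  then show ?thesis using \<open>G 0 = 0\<close> by simp
next
  case False
  let ?\<phi> = "\<lambda>s. C / 2 * exp (2 * K * s)"
  have "norm (G t - G 0) \<le> ?\<phi> t - ?\<phi> 0"
  proof (rule differentiable_bound_general)
    show "continuous_on {0..t} G"
      using der by (meson continuous_at_imp_continuous_on has_vector_derivative_continuous)
    show "(?\<phi> has_vector_derivative C * K * exp (2 * K * s)) (at s)" for s
      unfolding has_real_derivative_iff_has_vector_derivative[symmetric]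
      by (auto intro!: derivative_eq_intros)
    show "norm (g s) \<le> C * K * exp (2 * K * s)" if "0 < s" for s
      using bound[of s] that by simp
  qed (use False \<open>t \<ge> 0\<close> der in \<open>auto intro!: continuous_intros\<close>)
  then show ?thesis using \<open>G 0 = 0\<close> by (simp add: algebra_simps)
qed

text \<open>Integrating \<open>K exp (2 K \<bar>s\<bar>)\<close> from \<open>0\<close> gives at most \<open>1/2\<close> times the weight
  \<open>exp (2 K \<bar>t\<bar>)\<close>. This factor makes the Picard operator below a contraction, and the rate
  \<open>2 K\<close> is chosen for it.\<close>

lemma exp_weighted_growth:
  fixes G :: "real \<Rightarrow> 'a::real_normed_vector"
  assumes "K > 0" and "G 0 = 0"
    and der: "\<And>t. (G has_vector_derivative g t) (at t)"
    and bound: "\<And>t. norm (g t) \<le> C * K * exp (2 * K * \<bar>t\<bar>)"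
  shows "norm (G t) \<le> C / 2 * exp (2 * K * \<bar>t\<bar>)"
proof -
  have "0 \<le> C * K" using order_trans[OF norm_ge_zero bound[of 0]] by simp
  then have "C \<ge> 0" using \<open>K > 0\<close> by (simp add: zero_le_mult_iff)
  have "norm (G t) \<le> C / 2 * (exp (2 * K * \<bar>t\<bar>) - 1)"
  proof (cases "t \<ge> 0")
    case True
    then show ?thesis
      using exp_weighted_growth_forward[OF assms(1,2) der bound True] by simp
  next
    case False
    have "(uminus has_vector_derivative - 1) (at s)" for s :: real
      by (auto intro!: derivative_eq_intros)
    then have "((\<lambda>s. G (- s)) has_vector_derivative - g (- s)) (at s)" for s
      using vector_diff_chain_at[of uminus "-1" s G "g (- s)"] der by (simp add: o_def)
    then show ?thesis
      using exp_weighted_growth_forward[of K "\<lambda>s. G (- s)" "\<lambda>s. - g (- s)" C "- t"]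
        assms(1,2) bound[of "- _"] False by simp
  qed
  with \<open>C \<ge> 0\<close> show ?thesis by (simp add: algebra_simps)
qed

text \<open>Existence on all of \<open>\<real>\<close> in one step: Picard's operator is conjugated with the weight
  \<open>exp (2 K \<bar>t\<bar>)\<close>, so that a solution of at most this growth becomes a fixed point among the
  bounded continuous functions. There the operator contracts by \<open>1/2\<close>, and no local solutions
  have to be glued. The condition \<open>F t 0 = 0\<close> keeps the operator inside the bounded functions.\<close>

lemma global_Picard:
  fixes F :: "real \<Rightarrow> 'a::euclidean_space \<Rightarrow> 'a"
  assumes cont: "continuous_on UNIV (\<lambda>(t, x). F t x)"
    and lip: "\<And>t x y. norm (F t x - F t y) \<le> K * norm (x - y)"
    and zero: "\<And>t. F t 0 = 0"
    and "K > 0"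
  shows "\<exists>x. x 0 = c \<and> (\<forall>t. (x has_vector_derivative F t (x t)) (at t))"
proof -
  obtain J :: "(real \<Rightarrow> 'a) \<Rightarrow> real \<Rightarrow> 'a" where
    J0: "\<And>f. continuous_on UNIV f \<Longrightarrow> J f 0 = 0" and
    J: "\<And>f t. continuous_on UNIV f \<Longrightarrow> (J f has_vector_derivative f t) (at t)"
    using ex_antiderivative_vanishing_at_0 by metis
  define w where "w t = exp (2 * K * \<bar>t\<bar>)" for t
  define f where "f z t = F t (w t *\<^sub>R apply_bcontfun z t)" for z t
  define \<Phi> where "\<Phi> z t = (c + J (f z) t) /\<^sub>R w t" for z t
  have w_ge: "w t \<ge> 1" for t using \<open>K > 0\<close> by (simp add: w_def)
  have w_pos: "w t > 0" for t by (simp add: w_def)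
  have cont_w: "continuous_on UNIV w"
    unfolding w_def by (intro continuous_intros)
  have cont_f: "continuous_on UNIV (f z)" for z
  proof -
    have "continuous_on UNIV (\<lambda>t. (t, w t *\<^sub>R apply_bcontfun z t))"
      by (intro continuous_intros cont_w) simp
    from continuous_on_compose2[OF cont this] show ?thesis
      by (simp add: f_def[abs_def])
  qed
  have cont_J: "continuous_on UNIV (J (f z))" for z
    using J[OF cont_f] by (meson continuous_at_imp_continuous_on has_vector_derivative_continuous)
  have f_diff: "norm (f z t - f z' t) \<le> dist z z' * K * w t" for z z' t
  proof -
    have "norm (f z t - f z' t) \<le> K * norm (w t *\<^sub>R z t - w t *\<^sub>R z' t)"
      unfolding f_def by (rule lip)
    also have "\<dots> = K * w t * dist (z t) (z' t)"
      using w_pos[of t] by (simp add: dist_norm flip: scaleR_diff_right)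
    also have "\<dots> \<le> K * w t * dist z z'"
      using \<open>K > 0\<close> w_pos[of t] dist_bounded[of z t z'] by (intro mult_left_mono) auto
    finally show ?thesis by (simp add: mult_ac)
  qed
  have J_diff: "norm (J (f z) t - J (f z') t) \<le> dist z z' / 2 * w t" for z z' t
    unfolding w_def
    by (rule exp_weighted_growth[where G = "\<lambda>t. J (f z) t - J (f z') t"
          and g = "\<lambda>t. f z t - f z' t", OF \<open>K > 0\<close>])
      (use f_diff J J0 cont_f in \<open>auto simp: w_def intro!: has_vector_derivative_diff\<close>)
  have J_bound: "norm (J (f z) t) \<le> dist z 0 / 2 * w t" for z t
    unfolding w_def
    by (rule exp_weighted_growth[where G = "J (f z)" and g = "f z", OF \<open>K > 0\<close>])
      (use f_diff[of z _ 0] J[OF cont_f] J0[OF cont_f] in \<open>auto simp: w_def f_def zero\<close>)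
  have \<Phi>_bcont: "\<Phi> z \<in> bcontfun" for z
  proof (rule bcontfun_normI)
    show "continuous_on UNIV (\<Phi> z)"
      unfolding \<Phi>_def[abs_def] using w_pos
      by (intro continuous_intros cont_w cont_J) (auto simp: less_imp_neq[THEN not_sym])
    show "norm (\<Phi> z t) \<le> norm c + dist z 0 / 2" for t
    proof -
      have "norm (c + J (f z) t) \<le> norm c * w t + dist z 0 / 2 * w t"
        using norm_triangle_ineq[of c "J (f z) t"] J_bound[of z t]
          mult_left_mono[OF w_ge[of t], of "norm c"] by simp
      then show ?thesis
        using w_pos[of t]
        by (simp add: \<Phi>_def divide_inverse_commute[symmetric] pos_divide_le_eq distrib_right)
    qed
  qed
  define P where "P z = Bcontfun (\<Phi> z)" for z
  have P_apply: "apply_bcontfun (P z) t = \<Phi> z t" for z t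
    by (simp add: P_def Bcontfun_inverse \<Phi>_bcont)
  have "dist (P z) (P z') \<le> 1 / 2 * dist z z'" for z z'
  proof (rule dist_bound)
    fix t
    have "dist (P z t) (P z' t) = norm (J (f z) t - J (f z') t) / w t"
      using w_pos[of t]
      by (simp add: P_apply \<Phi>_def dist_norm divide_inverse_commute flip: scaleR_diff_right)
    also have "\<dots> \<le> 1 / 2 * dist z z'"
      using J_diff[of z t z'] w_pos[of t] by (simp add: field_simps)
    finally show "dist (P z t) (P z' t) \<le> 1 / 2 * dist z z'" .
  qed
  then obtain z where z: "P z = z"
    using banach_fix_type[of "1/2" P] by auto
  define x where "x t = c + J (f z) t" for t
  \<comment> \<open>Undoing the weight turns the fixed point into the integral equation for \<open>x\<close>.\<close>
  have x: "x t = w t *\<^sub>R z t" for t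
    using P_apply[of z t] w_pos[of t] by (simp add: z \<Phi>_def x_def)
  have "(x has_vector_derivative F t (x t)) (at t)" for t
  proof -
    have "(x has_vector_derivative f z t) (at t)"
      using J[OF cont_f, of z t]
      by (simp add: x_def[abs_def] has_vector_derivative_add_const add.commute[of c])
    then show ?thesis by (simp add: f_def x)
  qed
  moreover have "x 0 = c" using J0[OF cont_f] by (simp add: x_def)
  ultimately show ?thesis by blast
qed

section \<open>Quaternionic matrices\<close>

lemma quat_matrix_vector_scaleR:
  fixes A :: "quat ^ 'n ^ 'm"
  shows "A *v (r *\<^sub>R x) = r *\<^sub>R (A *v x)" "(r *\<^sub>R A) *v x = r *\<^sub>R (A *v x)"
  by (simp_all add: matrix_vector_mult_def vec_eq_iff scaleR_sum_right)

lemma bounded_bilinear_quat_matrix_vector: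
  "bounded_bilinear ((*v) :: quat ^ 'n ^ 'm \<Rightarrow> _)"
  unfolding bilinear_conv_bounded_bilinear[symmetric] bilinear_def
  by (auto intro!: linearI simp: quat_matrix_vector_scaleR
      matrix_vector_right_distrib matrix_vector_mult_add_rdistrib)

lemma bounded_bilinear_quat_matrix_matrix:
  "bounded_bilinear ((**) :: quat ^ 'n ^ 'm \<Rightarrow> quat ^ 'p ^ 'n \<Rightarrow> _)"
  unfolding bilinear_conv_bounded_bilinear[symmetric] bilinear_def
  by (auto intro!: linearI simp: matrix_matrix_mult_def vec_eq_iff scaleR_sum_right
      distrib_left distrib_right sum.distrib)

text \<open>Left multiplication by \<open>B\<close> is a real-linear map of a finite-dimensional real space, hence
  surjective once it is injective. This replaces the usual determinant argument, which needs commuting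
  entries.\<close>

lemma quat_matrix_left_inverse_imp_right_inverse:
  fixes B C :: "quat ^ 'n ^ 'n"
  assumes "C ** B = mat 1"
  shows "B ** C = mat 1"
proof -
  have "linear ((**) B :: quat ^ 'n ^ 'n \<Rightarrow> _)"
    by (intro bounded_linear.linear bounded_bilinear.bounded_linear_right
        bounded_bilinear_quat_matrix_matrix)
  moreover have "inj ((**) B :: quat ^ 'n ^ 'n \<Rightarrow> _)"
    by (metis assms injI matrix_mul_assoc matrix_mul_lid)
  ultimately have "surj ((**) B :: quat ^ 'n ^ 'n \<Rightarrow> _)"
    by (rule linear_injective_imp_surjective) simp
  then obtain D where "B ** D = mat 1" by (metis surjD)
  then show ?thesis
    using assms by (metis matrix_mul_assoc matrix_mul_lid matrix_mul_rid)
qed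

lemma matrix_inv_of_invertible:
  fixes M :: "'a::semiring_1 ^ 'n ^ 'm"
  assumes "invertible M"
  shows "M ** matrix_inv M = mat 1" "matrix_inv M ** M = mat 1"
  using someI_ex[OF assms[unfolded invertible_def]] by (simp_all add: matrix_inv_def)

section \<open>Linear systems with bounded coefficients\<close>

lemma periodic_continuous_imp_bounded:
  fixes f :: "real \<Rightarrow> 'a::real_normed_vector"
  assumes "T > 0" and "continuous_on UNIV f" and per: "\<forall>t. f (t + T) = f t"
  shows "\<exists>B>0. \<forall>t. norm (f t) \<le> B"
proof -
  \<comment> \<open>Any \<open>t\<close> is moved into the compact period interval by a multiple of \<open>T\<close>.\<close>
  have shift_nat: "f (t + real k * T) = f t" for k t
  proof (induction k)
    case (Suc k)
    have "f (t + real (Suc k) * T) = f ((t + real k * T) + T)"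
      by (simp add: algebra_simps)
    with Suc per show ?case by metis
  qed simp
  have shift: "f (t + of_int k * T) = f t" for k t
    using shift_nat[of t "nat k"] shift_nat[of "t + of_int k * T" "nat (- k)"]
    by (cases "k \<ge> 0") auto
  have "compact (f ` {0..T})"
    using assms(2) by (intro compact_continuous_image continuous_on_subset[OF assms(2)]) auto
  then obtain B where "B > 0" and B: "\<And>t. t \<in> {0..T} \<Longrightarrow> norm (f t) \<le> B"
    using compact_imp_bounded[OF \<open>compact (f ` {0..T})\<close>] unfolding bounded_pos by auto
  have "norm (f t) \<le> B" for t
  proof -
    define s where "s = t - \<lfloor>t / T\<rfloor> * T"
    have "s \<in> {0..T}"
      using floor_divide_lower[OF \<open>T > 0\<close>, of t] floor_divide_upper[OF \<open>T > 0\<close>, of t]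
      by (simp add: s_def algebra_simps)
    moreover have "f t = f s" using shift[of s "\<lfloor>t / T\<rfloor>"] by (simp add: s_def)
    ultimately show ?thesis using B by simp
  qed
  with \<open>B > 0\<close> show ?thesis by blast
qed

text \<open>A bilinear \<open>h\<close> covers the matrix equation \<open>M' = A M\<close> and, with its arguments exchanged, the
  adjoint equation \<open>N' = - N A\<close>.\<close>

lemma ex_solution_bilinear:
  fixes h :: "'a::real_normed_vector \<Rightarrow> 'b::euclidean_space \<Rightarrow> 'b"
  assumes bil: "bounded_bilinear h"
    and cont: "continuous_on UNIV A" and bound: "\<And>t. norm (A t) \<le> B"
  shows "\<exists>x. x 0 = c \<and> (\<forall>t. (x has_vector_derivative h (A t) (x t)) (at t))"
proof -
  interpret bounded_bilinear h by (rule bil)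
  obtain L where "L > 0" and L: "\<And>a b. norm (h a b) \<le> norm a * norm b * L"
    using pos_bounded by blast
  have B: "B \<ge> 0" using order_trans[OF norm_ge_zero bound] .
  show ?thesis
  proof (rule global_Picard)
    have "continuous_on UNIV (\<lambda>p. h (A (fst p)) (snd p))"
      by (intro continuous_on continuous_intros continuous_on_compose2[OF cont]) auto
    then show "continuous_on UNIV (\<lambda>(t, x). h (A t) x)"
      by (simp add: case_prod_unfold)
    \<comment> \<open>\<open>B + 1\<close> instead of \<open>B\<close> makes the Lipschitz constant positive even if \<open>A\<close> vanishes.\<close>
    show "norm (h (A t) x - h (A t) y) \<le> ((B + 1) * L) * norm (x - y)" for t x y
    proof -
      have "norm (h (A t) (x - y)) \<le> norm (A t) * norm (x - y) * L" by (rule L)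
      also have "\<dots> \<le> (B + 1) * norm (x - y) * L"
        using bound[of t] \<open>L > 0\<close> by (intro mult_right_mono) auto
      finally show ?thesis by (simp add: diff_right mult_ac)
    qed
    show "(B + 1) * L > 0" using B \<open>L > 0\<close> by simp
  qed (rule zero_right)
qed

lemma constant_if_vector_derivative_zero:
  fixes f :: "real \<Rightarrow> 'a::real_normed_vector"
  assumes "\<And>t. (f has_vector_derivative 0) (at t)"
  shows "f t = f s"
  using has_vector_derivative_zero_constant[of UNIV f] assms by (metis UNIV_I convex_UNIV)

text \<open>The solution \<open>N\<close> of the adjoint equation \<open>N' = - N A\<close> with \<open>N 0 = 1\<close> does all the work:
  \<open>N M\<close> and \<open>N x\<close>, for any solution \<open>x\<close>, have derivative \<open>0\<close>. So \<open>N\<close> inverts \<open>M\<close>, and \<open>N x = x 0\<close>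
  gives \<open>x = M (x 0)\<close>: uniqueness without a Gronwall estimate.\<close>

lemma ex_principal_fundamental_matrix:
  fixes A :: "real \<Rightarrow> quat ^ 'n ^ 'n"
  assumes cont: "continuous_on UNIV A" and bound: "\<And>t. norm (A t) \<le> B"
  shows "\<exists>M. fundamental_matrix A M \<and> M 0 = mat 1 \<and>
    (\<forall>x. is_solution A x \<longrightarrow> (\<forall>t. x t = M t *v x 0))"
proof -
  note mm = bounded_bilinear_quat_matrix_matrix[where 'n = 'n and 'm = 'n and 'p = 'n]
  note mv = bounded_bilinear_quat_matrix_vector[where 'n = 'n and 'm = 'n]
  obtain M :: "real \<Rightarrow> quat ^ 'n ^ 'n" where M0: "M 0 = mat 1"
    and M: "\<And>t. (M has_vector_derivative A t ** M t) (at t)"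
    using ex_solution_bilinear[OF mm cont bound] by blast
  obtain N :: "real \<Rightarrow> quat ^ 'n ^ 'n" where N0: "N 0 = mat 1"
    and N: "\<And>t. (N has_vector_derivative N t ** (- A t)) (at t)"
    using ex_solution_bilinear[OF bounded_bilinear.flip[OF mm],
        of "\<lambda>t. - A t" B "mat 1"] cont bound
    by (auto intro: continuous_intros)
  have "((\<lambda>t. N t ** M t) has_vector_derivative 0) (at t)" for t
    using bounded_bilinear.has_vector_derivative[OF mm N M, of t]
    by (simp add: matrix_mul_assoc bounded_bilinear.minus_left[OF mm]
        bounded_bilinear.minus_right[OF mm])
  then have NM: "N t ** M t = mat 1" for t
    using constant_if_vector_derivative_zero[of "\<lambda>t. N t ** M t" t 0] M0 N0 by simp
  then have MN: "M t ** N t = mat 1" for t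
    by (rule quat_matrix_left_inverse_imp_right_inverse)
  have "fundamental_matrix A M"
    unfolding fundamental_matrix_def invertible_def using M NM MN by blast
  moreover have "x t = M t *v x 0" if "is_solution A x" for x t
  proof -
    have x: "(x has_vector_derivative A t *v x t) (at t)" for t
      using that by (simp add: is_solution_def)
    have "((\<lambda>t. N t *v x t) has_vector_derivative 0) (at t)" for t
      using bounded_bilinear.has_vector_derivative[OF mv N x, of t]
      by (simp add: matrix_vector_mul_assoc bounded_bilinear.minus_left[OF mv]
          bounded_bilinear.minus_right[OF mm])
    then have "N t *v x t = x 0"
      using constant_if_vector_derivative_zero[of "\<lambda>t. N t *v x t" t 0] N0 by simp
    then show ?thesis
      by (metis MN matrix_vector_mul_assoc matrix_vector_mul_lid)
  qed
  ultimately show ?thesis using M0 by blast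
qed

section \<open>Periodic solutions and multipliers\<close>

lemma is_solution_shift:
  assumes "is_solution A x" and "\<forall>t. A (t + T) = A t"
  shows "is_solution A (\<lambda>t. x (t + T))"
  unfolding is_solution_def
proof
  fix t
  have "((\<lambda>s. s + T) has_vector_derivative 1) (at t)"
    by (auto intro!: derivative_eq_intros)
  moreover have "(x has_vector_derivative A (t + T) *v x (t + T)) (at (t + T))"
    using assms(1) by (simp add: is_solution_def)
  ultimately show "((\<lambda>t. x (t + T)) has_vector_derivative A t *v x (t + T)) (at t)"
    using vector_diff_chain_at[of "\<lambda>s. s + T" 1 t x] assms(2) by (simp add: o_def)
qed

lemma is_solution_scaleR:
  fixes A :: "real \<Rightarrow> quat ^ 'n ^ 'n"
  assumes "is_solution A x"
  shows "is_solution A (\<lambda>t. r *\<^sub>R x t)"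
  using assms unfolding is_solution_def
  by (auto simp: quat_matrix_vector_scaleR
      intro: bounded_linear.has_vector_derivative[OF bounded_linear_scaleR_right])

lemma is_solution_fundamental_matrix_mult:
  fixes A :: "real \<Rightarrow> quat ^ 'n ^ 'n"
  assumes "fundamental_matrix A M"
  shows "is_solution A (\<lambda>t. M t *v v)"
  unfolding is_solution_def
proof
  fix t
  have "(M has_vector_derivative A t ** M t) (at t)"
    using assms by (simp add: fundamental_matrix_def)
  from bounded_linear.has_vector_derivative[OF
      bounded_bilinear.bounded_linear_left[OF bounded_bilinear_quat_matrix_vector] this]
  show "((\<lambda>t. M t *v v) has_vector_derivative A t *v (M t *v v)) (at t)"
    by (simp add: matrix_vector_mul_assoc)
qed

lemma quat_of_complex_real_mult:
  "x * quat_of_complex (complex_of_real r) = r *\<^sub>R x"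
  by (simp add: quat_eq_iff quat_of_complex_def algebra_simps)

text \<open>A multiplier \<open>r\<close> is read off at time \<open>0\<close>, as \<open>x T = r x 0\<close>. Because \<open>A\<close> is periodic, \<open>x (t + T)\<close>
  and \<open>r x t\<close> both solve the system, so the relation holds for all times. Any fundamental
  matrix may witness a multiplier; for the converse the principal one does.\<close>

lemma characteristic_multiplier_real_iff:
  fixes A :: "real \<Rightarrow> quat ^ 'n ^ 'n"
  assumes "T > 0" and "continuous_on UNIV A" and per: "\<forall>t. A (t + T) = A t"
  shows "characteristic_multiplier A T (complex_of_real r) \<longleftrightarrow>
    (\<exists>x. is_solution A x \<and> (\<forall>t. x (t + T) = r *\<^sub>R x t) \<and> (\<exists>t. x t \<noteq> 0))"
proof -
  obtain B where "\<And>t. norm (A t) \<le> B"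
    using periodic_continuous_imp_bounded[OF assms] by blast
  then obtain P where P: "fundamental_matrix A P" "P 0 = mat 1"
    and sol: "\<And>x t. is_solution A x \<Longrightarrow> x t = P t *v x 0"
    using ex_principal_fundamental_matrix[OF assms(2)] by blast
  show ?thesis
  proof
    assume "characteristic_multiplier A T (complex_of_real r)"
    then obtain M v where M: "fundamental_matrix A M" and "v \<noteq> 0"
      and "(matrix_inv (M 0) ** M T) *v v = (\<chi> i. v $ i * quat_of_complex (complex_of_real r))"
      by (auto simp: characteristic_multiplier_def monodromy_matrix_def standard_eigenvalue_def)
    then have eig: "(matrix_inv (M 0) ** M T) *v v = r *\<^sub>R v"
      by (simp add: quat_of_complex_real_mult vec_eq_iff)
    have inv: "M 0 ** matrix_inv (M 0) = mat 1" "matrix_inv (M 0) ** M 0 = mat 1"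
      using M by (auto simp: fundamental_matrix_def intro: matrix_inv_of_invertible)
    define x where "x t = M t *v v" for t
    have x: "is_solution A x"
      using is_solution_fundamental_matrix_mult[OF M] by (simp add: x_def[abs_def])
    have "x T = M 0 *v ((matrix_inv (M 0) ** M T) *v v)"
      by (simp add: x_def matrix_vector_mul_assoc matrix_mul_assoc inv)
    then have "x T = r *\<^sub>R x 0"
      by (simp add: eig x_def quat_matrix_vector_scaleR)
    then have "x (t + T) = r *\<^sub>R x t" for t
      using sol[OF is_solution_shift[OF x per], of t] sol[OF is_solution_scaleR[OF x], of r t]
      by simp
    moreover have "x 0 \<noteq> 0"
      using \<open>v \<noteq> 0\<close> inv(2) unfolding x_def
      by (metis matrix_vector_mul_assoc matrix_vector_mul_lid matrix_vector_mult_0_right)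
    ultimately show "\<exists>x. is_solution A x \<and> (\<forall>t. x (t + T) = r *\<^sub>R x t) \<and> (\<exists>t. x t \<noteq> 0)"
      using x by blast
  next
    assume "\<exists>x. is_solution A x \<and> (\<forall>t. x (t + T) = r *\<^sub>R x t) \<and> (\<exists>t. x t \<noteq> 0)"
    then obtain x where x: "is_solution A x" "\<And>t. x (t + T) = r *\<^sub>R x t" "\<exists>t. x t \<noteq> 0"
      by blast
    have "x 0 \<noteq> 0"
      using x(3) sol[OF x(1)] by (metis matrix_vector_mult_0_right)
    have "matrix_inv (mat 1 :: quat ^ 'n ^ 'n) = mat 1"
      using matrix_inv_of_invertible(1)[of "mat 1 :: quat ^ 'n ^ 'n"]
      by (auto simp: invertible_def)
    then have "monodromy_matrix A T (P T)"
      using P unfolding monodromy_matrix_def by (intro exI[of _ P]) simp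
    moreover have "P T *v x 0 = (\<chi> i. x 0 $ i * quat_of_complex (complex_of_real r))"
      using sol[OF x(1), of T] x(2)[of 0] by (simp add: quat_of_complex_real_mult vec_eq_iff)
    ultimately show "characteristic_multiplier A T (complex_of_real r)"
      using \<open>x 0 \<noteq> 0\<close> unfolding characteristic_multiplier_def standard_eigenvalue_def by auto
  qed
qed

theorem corollary4p10:
  fixes A :: "real \<Rightarrow> quat ^ 'n ^ 'n" and T :: real
  assumes "T > 0"
    and "continuous_on UNIV A"
    and "\<forall>t. A (t + T) = A t"
  shows "((\<exists>x. nontrivial_periodic_solution A T x) \<longleftrightarrow> characteristic_exponent A T 0)
    \<and> ((\<exists>x. nontrivial_periodic_solution A T x) \<longleftrightarrow> characteristic_multiplier A T 1)
    \<and> ((\<exists>k::int. characteristic_exponent A T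
            (complex_of_real ((2 * real_of_int k + 1) / T * pi) * \<i>))
          \<longrightarrow> (\<exists>x. nontrivial_periodic_solution A (2 * T) x))
    \<and> ((\<exists>k::int. characteristic_exponent A T
            (complex_of_real ((2 * real_of_int k + 1) / T * pi) * \<i>))
          \<longleftrightarrow> characteristic_multiplier A T (-1))"
proof -
  have one: "(\<exists>x. nontrivial_periodic_solution A T x) \<longleftrightarrow> characteristic_multiplier A T 1"
    using characteristic_multiplier_real_iff[OF assms, of 1]
    by (simp add: nontrivial_periodic_solution_def)
  have zero: "characteristic_exponent A T 0 \<longleftrightarrow> characteristic_multiplier A T 1"
    by (simp add: characteristic_exponent_def)
  have "exp (complex_of_real ((2 * real_of_int k + 1) / T * pi) * \<i> * complex_of_real T) = -1"
    for k :: int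
  proof -
    have "complex_of_real ((2 * real_of_int k + 1) / T * pi) * \<i> * complex_of_real T =
        complex_of_real (2 * real_of_int k * pi) * \<i> + complex_of_real pi * \<i>"
      using \<open>T > 0\<close> by (simp add: field_simps)
    then show ?thesis
      using exp_integer_2pi[of "real_of_int k"] by (simp add: exp_add mult_ac)
  qed
  then have minus_one: "(\<exists>k::int. characteristic_exponent A T
        (complex_of_real ((2 * real_of_int k + 1) / T * pi) * \<i>))
      \<longleftrightarrow> characteristic_multiplier A T (-1)"
    by (simp add: characteristic_exponent_def)
  have double: "\<exists>x. nontrivial_periodic_solution A (2 * T) x"
    if "characteristic_multiplier A T (-1)"
  proof -
    have "characteristic_multiplier A T (complex_of_real (-1))" using that by simp
    then obtain x where "is_solution A x" and anti: "\<And>t. x (t + T) = - x t"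
      and "\<exists>t. x t \<noteq> 0"
      unfolding characteristic_multiplier_real_iff[OF assms] by auto
    moreover have "x (t + 2 * T) = x t" for t
      using anti[of "t + T"] anti[of t] by (simp add: add.assoc)
    ultimately show ?thesis
      by (auto simp: nontrivial_periodic_solution_def)
  qed
  show ?thesis using one zero minus_one double by blast
qed

end
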